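(* Let $z_0,z_1,z_2,z_3$ be pairwise distinct points of $\mathbb{C}_\infty$, and let $f:\mathbb{C}_\infty\to\mathbb{C}_\infty$ be a linear fractional transformation mapping $z_k$ to $z_k'$ for $k=0,1,2,3$. Then $$[z_0,z_1,z_2,z_3]=[z_0',z_1',z_2',z_3'],$$ where $[\cdot,\cdot,\cdot,\cdot]$ denotes the cross ratio.
   Context: The extended complex plane is $\mathbb{C}_\infty=\mathbb{C}\cup\{\infty\}$, the disjoint union of $\mathbb{C}$ and one extra point $\infty$. A linear fractional transformation (Möbius transformation) is a function $f:\mathbb{C}_\infty\to\mathbb{C}_\infty$ given by some $a,b,c,d\in\mathbb{C}$ with $ad-bc\neq 0$ as follows. If $c=0$: $f(z)=(a/d)z+(b/d)$ for $z\in\mathbb{C}$ and $f(\infty)=\infty$. If $c\neq 0$: $f(z)=\frac{az+b}{cz+d}$ for $z\in\mathbb{C}$, $z\neq -d/c$; $f(-d/c)=\infty$; and $f(\infty)=a/c$. The cross ratio of four pairwise distinct points $z_0,z_1,z_2,z_3\in\mathbb{C}_\infty$ (so that at most one of them is $\infty$) is defined by - all four finite: $[z_0,z_1,z_2,z_3]=\frac{z_0-z_1}{z_0-z_3}\cdot\frac{z_2-z_3}{z_2-z_1}$; - $z_0=\infty$: $[z_0,z_1,z_2,z_3]=\frac{z_2-z_3}{z_2-z_1}$; - $z_1=\infty$: $[z_0,z_1,z_2,z_3]=\frac{z_2-z_3}{z_0-z_3}$; - $z_2=\infty$: $[z_0,z_1,z_2,z_3]=\frac{z_0-z_1}{z_0-z_3}$;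 - $z_3=\infty$: $[z_0,z_1,z_2,z_3]=\frac{z_0-z_1}{z_2-z_1}$. *)

theory Defs
  imports Complex_Main
begin

text \<open>The extra point is \<^term>\<open>None\<close>, as in the library's one-point compactification
  of a topological space.\<close>

type_synonym ext_complex = "complex option"

definition lft_map :: "complex \<Rightarrow> complex \<Rightarrow> complex \<Rightarrow> complex \<Rightarrow> ext_complex \<Rightarrow> ext_complex" where
  "lft_map a b c d w =
    (if c = 0 then
       (case w of
          Some z \<Rightarrow> Some ((a / d) * z + b / d)
        | None \<Rightarrow> None)
     else
       (case w of
          Some z \<Rightarrow> (if z = - d / c then None else Some ((a * z + b) / (c * z + d)))
        | None \<Rightarrow> Some (a / c)))"

definition linear_fractional :: "(ext_complex \<Rightarrow> ext_complex) \<Rightarrow> bool" where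
  "linear_fractional f \<longleftrightarrow> (\<exists>a b c d. a * d - b * c \<noteq> 0 \<and> f = lft_map a b c d)"

text \<open>The value is meaningful only at pairwise distinct points; the last equation is reached only
  if at least two arguments are the point at infinity.\<close>

fun cross_ratio :: "ext_complex \<Rightarrow> ext_complex \<Rightarrow> ext_complex \<Rightarrow> ext_complex \<Rightarrow> complex" where
  "cross_ratio (Some z0) (Some z1) (Some z2) (Some z3) =
     ((z0 - z1) / (z0 - z3)) * ((z2 - z3) / (z2 - z1))"
| "cross_ratio None (Some z1) (Some z2) (Some z3) = (z2 - z3) / (z2 - z1)"
| "cross_ratio (Some z0) None (Some z2) (Some z3) = (z2 - z3) / (z0 - z3)"
| "cross_ratio (Some z0) (Some z1) None (Some z3) = (z0 - z1) / (z0 - z3)"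
| "cross_ratio (Some z0) (Some z1) (Some z2) None = (z0 - z1) / (z2 - z1)"
| "cross_ratio _ _ _ _ = undefined"

end

theory Submission
  imports Defs
begin

text \<open>In homogeneous coordinates on the projective line, the cross ratio is the quotient
  \<open>[p\<^sub>0 p\<^sub>1] [p\<^sub>2 p\<^sub>3] / ([p\<^sub>0 p\<^sub>3] [p\<^sub>2 p\<^sub>1])\<close> of two-by-two determinants, with no exceptional
  cases at infinity. A linear fractional transformation acts linearly on the coordinates, so each
  of the four determinants is multiplied by \<open>a d - b c\<close>, which cancels.\<close>

text \<open>A relation, since coordinates are fixed only up to a common nonzero factor; image
  vectors then need no normalisation.\<close>

definition homogeneous :: "ext_complex \<Rightarrow> complex \<Rightarrow> complex \<Rightarrow> bool" where
  "homogeneous p x y \<longleftrightarrow> (x \<noteq> 0 \<or> y \<noteq> 0) \<and> p = (if y = 0 then None else Some (x / y))"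

definition det2 :: "complex \<Rightarrow> complex \<Rightarrow> complex \<Rightarrow> complex \<Rightarrow> complex" where
  "det2 x y u v = x * v - u * y"

lemma homogeneous_exists: "\<exists>x y. homogeneous p x y"
proof (cases p)
  case None
  then have "homogeneous p 1 0" by (simp add: homogeneous_def)
  then show ?thesis by blast
next
  case (Some z)
  then have "homogeneous p z 1" by (simp add: homogeneous_def)
  then show ?thesis by blast
qed

text \<open>For nonzero vectors, a vanishing determinant means proportionality.\<close>

lemma homogeneous_eq_iff:
  assumes "homogeneous p x y" "homogeneous q u v"
  shows "p = q \<longleftrightarrow> det2 x y u v = 0"
  using assms by (auto simp: homogeneous_def det2_def frac_eq_eq split: if_splits)

text \<open>Multiplicativity of the determinant, with \<open>(x, y)\<close> and
  \<open>(u, v)\<close> as the columns of the right factor.\<close>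

lemma det2_linear:
  "det2 (a * x + b * y) (c * x + d * y) (a * u + b * v) (c * u + d * v)
    = (a * d - b * c) * det2 x y u v"
  by (simp add: det2_def algebra_simps)

lemma diff_divide_eq_det2:
  assumes "y \<noteq> 0" "v \<noteq> 0"
  shows "x / y - u / v = det2 x y u v / (y * v)"
  using assms by (simp add: det2_def diff_frac_eq)

lemma homogeneous_lft_map:
  assumes "a * d - b * c \<noteq> 0" and "homogeneous p x y"
  shows "homogeneous (lft_map a b c d p) (a * x + b * y) (c * x + d * y)"
proof -
  have "a * x + b * y \<noteq> 0 \<or> c * x + d * y \<noteq> 0"
  proof (rule ccontr)
    assume "\<not> ?thesis"
    then have zero: "a * x + b * y = 0" "c * x + d * y = 0" by auto
    \<comment> \<open>The adjugate matrix recovers \<open>x\<close> and \<open>y\<close> up to the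
      factor \<open>a * d - b * c\<close>, so no nonzero vector is sent to zero.\<close>
    have "(a * d - b * c) * x = d * (a * x + b * y) - b * (c * x + d * y)"
      "(a * d - b * c) * y = a * (c * x + d * y) - c * (a * x + b * y)"
      by (simp_all add: algebra_simps)
    then have "x = 0" "y = 0" using zero assms(1) by auto
    then show False using assms(2) by (simp add: homogeneous_def)
  qed
  moreover have "lft_map a b c d p =
    (if c * x + d * y = 0 then None else Some ((a * x + b * y) / (c * x + d * y)))"
  proof (cases "y = 0")
    case True
    with assms show ?thesis by (auto simp: homogeneous_def lft_map_def)
  next
    case False
    then have p: "p = Some (x / y)" using assms(2) by (simp add: homogeneous_def)
    show ?thesis
    proof (cases "c = 0")
      case True
      with assms(1) False show ?thesis by (auto simp: p lft_map_def field_simps)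
    next
      case c: False
      \<comment> \<open>The exceptional point of \<open>lft_map\<close> is where the second
        coordinate of the image vanishes.\<close>
      have pole: "x / y = - d / c \<longleftrightarrow> c * x + d * y = 0"
        using frac_eq_eq[OF False c, of x "- d"] by (simp add: eq_neg_iff_add_eq_0 mult.commute)
      have "(a * (x / y) + b) / (c * (x / y) + d)
          = ((a * x + b * y) / y) / ((c * x + d * y) / y)"
        using False by (simp add: add_divide_distrib)
      also have "\<dots> = (a * x + b * y) / (c * x + d * y)"
        using False by simp
      finally show ?thesis using c pole by (simp add: p lft_map_def)
    qed
  qed
  ultimately show ?thesis by (simp add: homogeneous_def)
qed

text \<open>Each index occurs once above and once below the fraction bar, so the \<open>y\<close>
  factors from clearing denominators cancel; for a point at infinity its \<open>x\<close> factor
  cancels instead, along with its sign.\<close>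

lemma cross_ratio_homogeneous:
  assumes dist: "distinct [p0, p1, p2, p3]"
    and hom: "homogeneous p0 x0 y0" "homogeneous p1 x1 y1"
      "homogeneous p2 x2 y2" "homogeneous p3 x3 y3"
  shows "cross_ratio p0 p1 p2 p3 =
    (det2 x0 y0 x1 y1 * det2 x2 y2 x3 y3) / (det2 x0 y0 x3 y3 * det2 x2 y2 x1 y1)"
proof -
  \<comment> \<open>Distinctness lets at most one \<open>y\<close> vanish; the five cases match the
    first five equations of \<open>cross_ratio\<close>.\<close>
  consider "y0 \<noteq> 0" "y1 \<noteq> 0" "y2 \<noteq> 0" "y3 \<noteq> 0"
    | "y0 = 0" "y1 \<noteq> 0" "y2 \<noteq> 0" "y3 \<noteq> 0"
    | "y0 \<noteq> 0" "y1 = 0" "y2 \<noteq> 0" "y3 \<noteq> 0"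
    | "y0 \<noteq> 0" "y1 \<noteq> 0" "y2 = 0" "y3 \<noteq> 0"
    | "y0 \<noteq> 0" "y1 \<noteq> 0" "y2 \<noteq> 0" "y3 = 0"
    using assms by (fastforce simp: homogeneous_def)
  then show ?thesis
    using hom
    by cases (simp_all add: homogeneous_def diff_divide_eq_det2, simp_all add: det2_def mult_ac)
qed

theorem theorem6p1:
  fixes z0 z1 z2 z3 z0' z1' z2' z3' :: ext_complex
    and f :: "ext_complex \<Rightarrow> ext_complex"
  assumes "distinct [z0, z1, z2, z3]"
    and "linear_fractional f"
    and "f z0 = z0'" and "f z1 = z1'" and "f z2 = z2'" and "f z3 = z3'"
  shows "cross_ratio z0 z1 z2 z3 = cross_ratio z0' z1' z2' z3'"
proof -
  obtain a b c d where det: "a * d - b * c \<noteq> 0" and f: "f = lft_map a b c d"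
    using assms(2) by (auto simp: linear_fractional_def)
  obtain x0 y0 x1 y1 x2 y2 x3 y3 where hom: "homogeneous z0 x0 y0" "homogeneous z1 x1 y1"
      "homogeneous z2 x2 y2" "homogeneous z3 x3 y3"
    using homogeneous_exists by metis
  note hom' = hom[THEN homogeneous_lft_map[OF det], folded f, unfolded assms(3-6)]
  \<comment> \<open>Injectivity of \<open>f\<close>, because \<open>cross_ratio_homogeneous\<close>
    must also be applied to the images, which have to be distinct.\<close>
  have "f p = f q \<longleftrightarrow> p = q" for p q
  proof -
    obtain x y u v where "homogeneous p x y" "homogeneous q u v"
      using homogeneous_exists by metis
    then show ?thesis
      using det by (simp add: f homogeneous_eq_iff[OF homogeneous_lft_map[OF det]
            homogeneous_lft_map[OF det]] homogeneous_eq_iff det2_linear)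
  qed
  then have "distinct [z0', z1', z2', z3']"
    using assms(1) by (simp flip: assms(3-6))
  from cross_ratio_homogeneous[OF this hom'] cross_ratio_homogeneous[OF assms(1) hom]
  show ?thesis using det by (simp add: det2_linear)
qed

end
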